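(* Let $X_1,X_2,\ldots,X_n$ be independent and identically distributed random variables with distribution function $F$, and let $(p_1,p_2,\ldots,p_n)\in D_+^1$. Then $$H_n(x)\equiv\sum_{i=1}^n p_i F_{n-i+1:n}(x)\ \le\ F(x)\ \le\ \sum_{i=1}^n p_i F_{i:n}(x)\equiv K_n(x)\qquad\text{for all } x\in\mathbb{R},$$ and the equality holds if and only if $(p_1,p_2,\ldots,p_n)=\left(\frac1n,\frac1n,\ldots,\frac1n\right)$.
   Context: $D_+^1=\{(x_1,x_2,\ldots,x_n) : x_i\ge 0,\ i=1,2,\ldots,n;\ x_1\ge x_2\ge\cdots\ge x_n,\ \sum_{i=1}^n x_i=1\}$. For the independent and identically distributed real random variables $X_1,\ldots,X_n$ with distribution function $F(x)=P\{X_1\le x\}$, the order statistics $X_{1:n}\le X_{2:n}\le\cdots\le X_{n:n}$ are the $X_j$ arranged in nondecreasing order, and $F_{i:n}(x)=P\{X_{i:n}\le x\}$ for $i=1,\ldots,n$.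
   Formalization: The "only if" part of the equality claim is stated at points x with 0 < F(x) < 1, and for equality at all x when F takes some value strictly between 0 and 1; where F(x) is 0 or 1 equality holds for every p. *)

theory Defs
  imports "HOL-Probability.Probability"
begin

text \<open>
  An n-tuple is a function on \<open>nat\<close> of which only the values at \<open>{1..n}\<close> matter.
\<close>

definition D_plus_1 :: "nat \<Rightarrow> (nat \<Rightarrow> real) set" where
  "D_plus_1 n = {p. (\<forall>i\<in>{1..n}. 0 \<le> p i) \<and>
                    (\<forall>i\<in>{1..n}. \<forall>j\<in>{1..n}. i \<le> j \<longrightarrow> p j \<le> p i) \<and>
                    (\<Sum>i=1..n. p i) = 1}"

definition order_stat :: "nat \<Rightarrow> (nat \<Rightarrow> 'a \<Rightarrow> real) \<Rightarrow> nat \<Rightarrow> 'a \<Rightarrow> real" where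
  "order_stat n X i \<omega> = sort (map (\<lambda>j. X j \<omega>) [1..<Suc n]) ! (i - 1)"

definition order_cdf ::
  "'a measure \<Rightarrow> nat \<Rightarrow> (nat \<Rightarrow> 'a \<Rightarrow> real) \<Rightarrow> nat \<Rightarrow> real \<Rightarrow> real" where
  "order_cdf M n X i x = \<P>(\<omega> in M. order_stat n X i \<omega> \<le> x)"

definition mix_H ::
  "'a measure \<Rightarrow> nat \<Rightarrow> (nat \<Rightarrow> 'a \<Rightarrow> real) \<Rightarrow> (nat \<Rightarrow> real) \<Rightarrow> real \<Rightarrow> real" where
  "mix_H M n X p x = (\<Sum>i=1..n. p i * order_cdf M n X (n - i + 1) x)"

definition mix_K ::
  "'a measure \<Rightarrow> nat \<Rightarrow> (nat \<Rightarrow> 'a \<Rightarrow> real) \<Rightarrow> (nat \<Rightarrow> real) \<Rightarrow> real \<Rightarrow> real" where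
  "mix_K M n X p x = (\<Sum>i=1..n. p i * order_cdf M n X i x)"

end

theory Submission imports Defs begin

text \<open>
  Let \<open>N\<close> be the number of indices \<open>j\<close> with \<open>X j \<le> x\<close>. The i-th order statistic is at most \<open>x\<close>
  iff \<open>i \<le> N\<close>, so its distribution function \<open>G i\<close> at \<open>x\<close> is the tail \<open>P(N \<ge> i)\<close>. These
  tails decrease in \<open>i\<close> and sum to \<open>E N = n F x\<close>, so both bounds are instances of Chebyshev's
  sum inequality. If \<open>0 < F x < 1\<close>, every value of \<open>N\<close> in \<open>{0..n}\<close> has positive probability by
  independence; the tails then decrease strictly, and equality forces constant weights.
\<close>

text \<open>The identity behind Chebyshev's sum inequality: of the four sums obtained by expanding,
  two collapse to \<open>card I\<close> copies of \<open>\<Sum>i\<in>I. p i * g i\<close> and two to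
  the product of the sums.\<close>

lemma sum_sum_diff_mult_diff:
  fixes p g :: "'b \<Rightarrow> real"
  shows "(\<Sum>i\<in>I. \<Sum>j\<in>I. (p i - p j) * (g i - g j)) =
    2 * (real (card I) * (\<Sum>i\<in>I. p i * g i) - (\<Sum>i\<in>I. p i) * (\<Sum>i\<in>I. g i))"
proof -
  have "(\<Sum>i\<in>I. \<Sum>j\<in>I. p i * g j) = (\<Sum>i\<in>I. p i) * (\<Sum>i\<in>I. g i)"
    and "(\<Sum>i\<in>I. \<Sum>j\<in>I. p j * g i) = (\<Sum>i\<in>I. p i) * (\<Sum>i\<in>I. g i)"
    by (simp_all add: sum_product sum.swap[of "\<lambda>i j. p j * g i"])
  then show ?thesis
    by (simp add: left_diff_distrib right_diff_distrib sum_subtractf sum.distrib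
        sum_distrib_left[symmetric])
qed

text \<open>Weights and \<open>g\<close> are ordered the same way, so each product of differences is
  nonnegative. If the double sum vanishes, so does each term; a strictly decreasing \<open>g\<close>
  then forces equal weights, and total mass 1 fixes their value.\<close>

lemma D_plus_1_weighted_sum:
  fixes g :: "nat \<Rightarrow> real"
  assumes p: "p \<in> D_plus_1 n" and n: "n \<ge> 1"
    and g: "\<And>i j. i \<in> {1..n} \<Longrightarrow> j \<in> {1..n} \<Longrightarrow> i \<le> j \<Longrightarrow> g j \<le> g i"
  shows D_plus_1_weighted_sum_ge: "(\<Sum>i=1..n. g i) / n \<le> (\<Sum>i=1..n. p i * g i)"
    and D_plus_1_weighted_sum_eq:
      "\<lbrakk>\<And>i j. i \<in> {1..n} \<Longrightarrow> j \<in> {1..n} \<Longrightarrow> i < j \<Longrightarrow> g j < g i;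
        (\<Sum>i=1..n. g i) / n = (\<Sum>i=1..n. p i * g i)\<rbrakk> \<Longrightarrow> \<forall>i\<in>{1..n}. p i = 1 / n"
proof -
  let ?S = "\<Sum>i=1..n. \<Sum>j=1..n. (p i - p j) * (g i - g j)"
  have psum: "(\<Sum>i=1..n. p i) = 1"
    using p by (simp add: D_plus_1_def)
  have pmono: "p j \<le> p i" if "i \<in> {1..n}" "j \<in> {1..n}" "i \<le> j" for i j
    using p that by (simp add: D_plus_1_def)
  have nonneg: "(p i - p j) * (g i - g j) \<ge> 0" if "i \<in> {1..n}" "j \<in> {1..n}" for i j
    using pmono[of i j] pmono[of j i] g[of i j] g[of j i] that
    by (cases "i \<le> j") (simp_all add: zero_le_mult_iff)
  have S: "?S = 2 * (n * (\<Sum>i=1..n. p i * g i) - (\<Sum>i=1..n. g i))"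
    unfolding sum_sum_diff_mult_diff psum by simp
  have "?S \<ge> 0"
    by (intro sum_nonneg nonneg)
  then show "(\<Sum>i=1..n. g i) / n \<le> (\<Sum>i=1..n. p i * g i)"
    using n unfolding S by (simp add: divide_simps mult.commute)
  assume strict: "\<And>i j. i \<in> {1..n} \<Longrightarrow> j \<in> {1..n} \<Longrightarrow> i < j \<Longrightarrow> g j < g i"
    and eq: "(\<Sum>i=1..n. g i) / n = (\<Sum>i=1..n. p i * g i)"
  have "?S = 0"
    using n unfolding S eq[symmetric] by simp
  then have zero: "(p i - p j) * (g i - g j) = 0" if "i \<in> {1..n}" "j \<in> {1..n}" for i j
  proof -
    have "\<forall>i\<in>{1..n}. (\<Sum>j=1..n. (p i - p j) * (g i - g j)) = 0"
      using \<open>?S = 0\<close> by (subst (asm) sum_nonneg_eq_0_iff) (auto intro!: sum_nonneg nonneg)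
    with that(1) have "(\<Sum>j=1..n. (p i - p j) * (g i - g j)) = 0"
      by blast
    then have "\<forall>j\<in>{1..n}. (p i - p j) * (g i - g j) = 0"
      by (subst (asm) sum_nonneg_eq_0_iff) (auto intro!: nonneg that(1))
    with that(2) show ?thesis
      by blast
  qed
  have const: "p j = p i" if "i \<in> {1..n}" "j \<in> {1..n}" for i j
    using zero[OF that] strict[of i j] strict[of j i] that by (cases i j rule: linorder_cases) auto
  show "\<forall>i\<in>{1..n}. p i = 1 / n"
  proof
    fix i assume i: "i \<in> {1..n}"
    have "1 = (\<Sum>j=1..n. p i)"
      unfolding psum[symmetric] by (intro sum.cong refl const[OF i])
    then show "p i = 1 / n"
      using n by (simp add: field_simps)
  qed
qed

text \<open>In a sorted list the entries at most \<open>x\<close> form an initial segment. Positions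
  start at 0, hence the strict inequality.\<close>

lemma sorted_nth_le_iff:
  fixes xs :: "'b::linorder list"
  assumes "sorted xs" "k < length xs"
  shows "xs ! k \<le> x \<longleftrightarrow> k < length (filter (\<lambda>y. y \<le> x) xs)"
  using assms
proof (induction xs arbitrary: k)
  case (Cons a xs)
  show ?case
  proof (cases "a \<le> x")
    case True
    with Cons show ?thesis by (cases k) auto
  next
    case False
    with Cons.prems have "\<forall>y\<in>set (a # xs). \<not> y \<le> x"
      by auto
    with Cons.prems show ?thesis
      by (metis filter_False length_0_conv not_less0 nth_mem)
  qed
qed simp

lemma order_stat_le_iff:
  assumes "i \<in> {1..n}"
  shows "order_stat n X i \<omega> \<le> x \<longleftrightarrow> i \<le> card {j \<in> {1..n}. X j \<omega> \<le> x}"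
proof -
  let ?xs = "map (\<lambda>j. X j \<omega>) [1..<Suc n]"
  have "length (filter (\<lambda>y. y \<le> x) (sort ?xs)) = length (filter (\<lambda>y. y \<le> x) ?xs)"
    by (metis filter_sort length_sort)
  \<comment> \<open>Indices are counted instead of values, so ties are not merged: the index list is
    distinct.\<close>
  also have "\<dots> = card (set (filter (\<lambda>j. X j \<omega> \<le> x) [1..<Suc n]))"
    by (subst distinct_card) (simp_all add: filter_map o_def del: upt_Suc)
  also have "set (filter (\<lambda>j. X j \<omega> \<le> x) [1..<Suc n]) = {j \<in> {1..n}. X j \<omega> \<le> x}"
    by auto
  finally have "length (filter (\<lambda>y. y \<le> x) (sort ?xs)) = card {j \<in> {1..n}. X j \<omega> \<le> x}" .
  moreover have "i - 1 < length (sort ?xs)"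
    using assms by (simp del: upt_Suc) arith
  ultimately have "order_stat n X i \<omega> \<le> x \<longleftrightarrow> i - 1 < card {j \<in> {1..n}. X j \<omega> \<le> x}"
    using sorted_nth_le_iff[of "sort ?xs" "i - 1" x] by (simp only: order_stat_def sorted_sort)
  \<comment> \<open>Since \<open>i \<ge> 1\<close>, the shift from \<open>i - 1 <\<close> to
    \<open>i \<le>\<close> is safe under truncated subtraction.\<close>
  then show ?thesis
    using assms by auto
qed

context prob_space
begin

lemma order_cdf_eq_prob_card:
  assumes "i \<in> {1..n}"
  shows "order_cdf M n X i x = \<P>(\<omega> in M. i \<le> card {j \<in> {1..n}. X j \<omega> \<le> x})"
  using assms by (simp add: order_cdf_def order_stat_le_iff)

lemma measurable_card_le [measurable]:
  fixes X :: "nat \<Rightarrow> 'a \<Rightarrow> real"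
  assumes [measurable]: "\<And>j. j \<in> {1..n} \<Longrightarrow> X j \<in> borel_measurable M"
  shows "(\<lambda>\<omega>. card {j \<in> {1..n}. X j \<omega> \<le> x}) \<in> measurable M (count_space UNIV)"
proof -
  have "(\<lambda>\<omega>. card {j \<in> {1..n}. X j \<omega> \<le> x}) = (\<lambda>\<omega>. \<Sum>j=1..n. if X j \<omega> \<le> x then 1 else 0)"
    by (auto simp: sum.If_cases Int_def)
  then show ?thesis by simp
qed

lemma order_cdf_antimono:
  assumes "\<And>j. j \<in> {1..n} \<Longrightarrow> X j \<in> borel_measurable M"
    and "i \<in> {1..n}" "j \<in> {1..n}" "i \<le> j"
  shows "order_cdf M n X j x \<le> order_cdf M n X i x"
  using assms measurable_card_le[OF assms(1)]
  by (auto simp: order_cdf_eq_prob_card intro!: finite_measure_mono)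

text \<open>Both sides are the expectation of the count: once as the sum of its tails, once as a sum
  of indicators over the variables.\<close>

lemma sum_order_cdf:
  fixes X :: "nat \<Rightarrow> 'a \<Rightarrow> real"
  assumes [measurable]: "\<And>j. j \<in> {1..n} \<Longrightarrow> X j \<in> borel_measurable M"
  shows "(\<Sum>i=1..n. order_cdf M n X i x) = (\<Sum>j=1..n. \<P>(\<omega> in M. X j \<omega> \<le> x))"
proof -
  define N where "N \<omega> = card {j \<in> {1..n}. X j \<omega> \<le> x}" for \<omega>
  have [measurable]: "N \<in> measurable M (count_space UNIV)"
    unfolding N_def by (rule measurable_card_le) simp
  have N_le: "N \<omega> \<le> n" for \<omega>
    unfolding N_def by (rule order_trans[OF card_mono[of "{1..n}"]]) auto
  have "(\<Sum>i=1..n. order_cdf M n X i x) =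
      (\<Sum>i=1..n. expectation (indicator {\<omega> \<in> space M. i \<le> N \<omega>}))"
    by (intro sum.cong refl) (simp add: order_cdf_eq_prob_card N_def)
  also have "\<dots> = expectation (\<lambda>\<omega>. \<Sum>i=1..n. indicator {\<omega> \<in> space M. i \<le> N \<omega>} \<omega>)"
    by (subst Bochner_Integration.integral_sum) (auto simp: integrable_indicator_iff less_top[symmetric])
  also have "\<dots> = expectation (\<lambda>\<omega>. \<Sum>j=1..n. indicator {\<omega> \<in> space M. X j \<omega> \<le> x} \<omega>)"
  proof (intro Bochner_Integration.integral_cong refl)
    fix \<omega> assume \<omega>: "\<omega> \<in> space M"
    have "(\<Sum>i=1..n. indicator {\<omega> \<in> space M. i \<le> N \<omega>} \<omega>) = real (card {i \<in> {1..n}. i \<le> N \<omega>})"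
      using \<omega> by (simp add: indicator_def sum.If_cases Int_def)
    \<comment> \<open>The tail sum stops at \<open>n\<close>; it recovers all of
      \<open>N \<omega>\<close> because \<open>N \<omega> \<le> n\<close>.\<close>
    also have "{i \<in> {1..n}. i \<le> N \<omega>} = {1..N \<omega>}"
      using N_le[of \<omega>] by auto
    also have "real (card \<dots>) = (\<Sum>j=1..n. indicator {\<omega> \<in> space M. X j \<omega> \<le> x} \<omega>)"
      using \<omega> by (simp add: indicator_def sum.If_cases Int_def N_def)
    finally show "(\<Sum>i=1..n. indicator {\<omega> \<in> space M. i \<le> N \<omega>} \<omega>) =
      (\<Sum>j=1..n. indicator {\<omega> \<in> space M. X j \<omega> \<le> x} \<omega> :: real)" .
  qed
  also have "\<dots> = (\<Sum>j=1..n. \<P>(\<omega> in M. X j \<omega> \<le> x))"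
    by (subst Bochner_Integration.integral_sum) (auto simp: integrable_indicator_iff less_top[symmetric])
  finally show ?thesis .
qed

text \<open>The event that the count equals \<open>i\<close> lies in the larger tail event but, as
  \<open>i < j\<close>, not in the smaller one. It suffices that its probability is
  positive.\<close>

lemma order_cdf_strict_antimono:
  fixes X :: "nat \<Rightarrow> 'a \<Rightarrow> real"
  assumes indep: "indep_vars (\<lambda>_. borel) X {1..n}"
    and pos: "\<And>j. j \<in> {1..n} \<Longrightarrow> 0 < \<P>(\<omega> in M. X j \<omega> \<le> x)"
    and lt1: "\<And>j. j \<in> {1..n} \<Longrightarrow> \<P>(\<omega> in M. X j \<omega> \<le> x) < 1"
    and ij: "i \<in> {1..n}" "j \<in> {1..n}" "i < j"
  shows "order_cdf M n X j x < order_cdf M n X i x"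
proof -
  have meas [measurable]: "\<And>j. j \<in> {1..n} \<Longrightarrow> X j \<in> borel_measurable M"
    using indep by (auto simp: indep_vars_def)
  define N where "N \<omega> = card {j \<in> {1..n}. X j \<omega> \<le> x}" for \<omega>
  have [measurable]: "N \<in> measurable M (count_space UNIV)"
    unfolding N_def by (rule measurable_card_le) simp
  \<comment> \<open>One configuration with count \<open>i\<close> is enough: the first
    \<open>i\<close> variables are at most \<open>x\<close> and the others exceed it.\<close>
  define A where "A k = (if k \<le> i then {..x} else {x<..})" for k :: nat
  have A [measurable]: "A k \<in> sets borel" for k
    by (simp add: A_def)
  have factor: "0 < prob (X k -` A k \<inter> space M)" if k: "k \<in> {1..n}" for k
  proof (cases "k \<le> i")
    case True
    then have "X k -` A k \<inter> space M = {\<omega> \<in> space M. X k \<omega> \<le> x}"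
      by (auto simp: A_def)
    then show ?thesis using pos[OF k] by simp
  next
    case False
    then have "X k -` A k \<inter> space M = {\<omega> \<in> space M. \<not> X k \<omega> \<le> x}"
      by (auto simp: A_def)
    moreover have "{\<omega> \<in> space M. X k \<omega> \<le> x} \<in> events"
      using k by measurable
    ultimately show ?thesis
      using lt1[OF k] prob_neg[of "\<lambda>\<omega>. X k \<omega> \<le> x"] by simp
  qed
  let ?B = "\<Inter>k\<in>{1..n}. X k -` A k \<inter> space M"
  have B: "?B \<in> events"
    \<comment> \<open>Membership of \<open>i\<close> makes the index set nonempty, as finite
      intersections and the product rule for independence require.\<close>
    using ij by (intro sets.finite_INT) (auto intro!: measurable_sets[OF meas A])
  have "prob ?B = (\<Prod>k\<in>{1..n}. prob (X k -` A k \<inter> space M))"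
    using ij by (intro indep_varsD[OF indep]) auto
  also have "\<dots> > 0"
    by (intro prod_pos ballI factor) simp
  finally have "0 < prob ?B" .
  moreover have "?B \<subseteq> {\<omega> \<in> space M. N \<omega> = i}"
  proof
    fix \<omega> assume \<omega>: "\<omega> \<in> ?B"
    have "{k \<in> {1..n}. X k \<omega> \<le> x} = {1..i}"
      using \<omega> ij by (fastforce simp: A_def split: if_splits)
    then show "\<omega> \<in> {\<omega> \<in> space M. N \<omega> = i}"
      using \<omega> ij by (auto simp: N_def)
  qed
  ultimately have "0 < prob {\<omega> \<in> space M. N \<omega> = i}"
    using finite_measure_mono[of ?B "{\<omega> \<in> space M. N \<omega> = i}"] by simp
  then have "prob {\<omega> \<in> space M. j \<le> N \<omega>} <
      prob {\<omega> \<in> space M. j \<le> N \<omega>} + prob {\<omega> \<in> space M. N \<omega> = i}"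
    by simp
  also have "\<dots> = prob ({\<omega> \<in> space M. j \<le> N \<omega>} \<union> {\<omega> \<in> space M. N \<omega> = i})"
    using ij by (intro finite_measure_Union[symmetric]) auto
  also have "\<dots> \<le> prob {\<omega> \<in> space M. i \<le> N \<omega>}"
    using ij by (intro finite_measure_mono) auto
  finally show ?thesis
    using ij by (simp add: order_cdf_eq_prob_card N_def)
qed

end

text \<open>Where \<open>F x\<close> is 0 or 1, all tails coincide and both bounds are equalities
  for every \<open>p\<close>. Thus equality determines the weights only through points with
  \<open>0 < F x < 1\<close>.\<close>

theorem lemma1:
  fixes M :: "'a measure" and X :: "nat \<Rightarrow> 'a \<Rightarrow> real" and n :: nat
    and F :: "real \<Rightarrow> real" and p :: "nat \<Rightarrow> real"
  assumes "prob_space M"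
    and "n \<ge> 1"
    and "prob_space.indep_vars M (\<lambda>_. borel) X {1..n}"
    and "\<forall>i\<in>{1..n}. distr M borel (X i) = distr M borel (X 1)"
    and "\<forall>x. F x = \<P>(\<omega> in M. X 1 \<omega> \<le> x)"
    and "p \<in> D_plus_1 n"
  shows "(\<forall>x. mix_H M n X p x \<le> F x \<and> F x \<le> mix_K M n X p x) \<and>
    ((\<forall>i\<in>{1..n}. p i = 1 / real n) \<longrightarrow>
       (\<forall>x. mix_H M n X p x = F x \<and> F x = mix_K M n X p x)) \<and>
    (\<forall>x. 0 < F x \<and> F x < 1 \<longrightarrow>
       (mix_H M n X p x = F x \<longleftrightarrow> (\<forall>i\<in>{1..n}. p i = 1 / real n)) \<and>
       (F x = mix_K M n X p x \<longleftrightarrow> (\<forall>i\<in>{1..n}. p i = 1 / real n))) \<and>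
    ((\<exists>x. 0 < F x \<and> F x < 1) \<longrightarrow>
       ((\<forall>x. mix_H M n X p x = F x) \<longleftrightarrow> (\<forall>i\<in>{1..n}. p i = 1 / real n)) \<and>
       ((\<forall>x. F x = mix_K M n X p x) \<longleftrightarrow> (\<forall>i\<in>{1..n}. p i = 1 / real n)))"
proof -
  interpret prob_space M by fact
  note n = assms(2) and p = assms(6)
  have meas: "\<And>j. j \<in> {1..n} \<Longrightarrow> X j \<in> borel_measurable M"
    using assms(3) by (auto simp: indep_vars_def)
  have F: "\<P>(\<omega> in M. X j \<omega> \<le> x) = F x" if j: "j \<in> {1..n}" for j x
  proof -
    \<comment> \<open>Equal laws are used only on the half-lines \<open>{..x}\<close>.\<close>
    have *: "\<P>(\<omega> in M. X k \<omega> \<le> x) = measure (distr M borel (X k)) {..x}" if "k \<in> {1..n}" for k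
      by (subst measure_distr) (auto simp: meas[OF that] intro!: arg_cong[where f = prob])
    have "1 \<in> {1..n}"
      using n by simp
    then show ?thesis
      using *[OF j] *[of 1] assms(4) assms(5) j by metis
  qed
  define G where "G x i = order_cdf M n X i x" for x i
  have K: "mix_K M n X p x = (\<Sum>i=1..n. p i * G x i)" for x
    by (simp add: mix_K_def G_def)
  \<comment> \<open>Reversing the index makes the tails increase; the sign change makes them
    decrease again, so the same inequality yields the upper bound on \<open>mix_H\<close>.\<close>
  have H: "mix_H M n X p x = - (\<Sum>i=1..n. p i * - G x (n - i + 1))" for x
    by (simp add: mix_H_def G_def sum_negf)
  have mean: "(\<Sum>i=1..n. G x i) / n = F x" for x
    using n sum_order_cdf[where x = x, OF meas] F by (simp add: G_def)
  have mean': "(\<Sum>i=1..n. - G x (n - i + 1)) / n = - F x" for x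
  proof -
    have "(\<Sum>i=1..n. G x (n - i + 1)) = (\<Sum>i=1..n. G x (n + 1 - i))"
      by (intro sum.cong) (auto simp: Suc_diff_le)
    also have "\<dots> = (\<Sum>i=1..n. G x i)"
      by (rule sum.atLeastAtMost_rev[symmetric])
    finally show ?thesis
      using mean[of x] by (simp add: sum_negf)
  qed
  have G: "G x j \<le> G x i" if "i \<in> {1..n}" "j \<in> {1..n}" "i \<le> j" for i j x
    unfolding G_def using meas that by (rule order_cdf_antimono)
  have G': "- G x (n - j + 1) \<le> - G x (n - i + 1)"
    if "i \<in> {1..n}" "j \<in> {1..n}" "i \<le> j" for i j x
    using that by (auto intro!: G)
  have bounds: "mix_H M n X p x \<le> F x \<and> F x \<le> mix_K M n X p x" for x
    using D_plus_1_weighted_sum_ge[of p n "G x", OF p n G]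
      D_plus_1_weighted_sum_ge[of p n "\<lambda>i. - G x (n - i + 1)", OF p n G']
    unfolding mean mean' K H by simp
  have uniform: "mix_H M n X p x = F x \<and> F x = mix_K M n X p x"
    if u: "\<forall>i\<in>{1..n}. p i = 1 / n" for x
  proof -
    \<comment> \<open>Uniform weights turn both mixtures into the mean of the tails, which is
      \<open>F x\<close>.\<close>
    have avg: "(\<Sum>i=1..n. p i * g i) = (\<Sum>i=1..n. g i) / n" for g :: "nat \<Rightarrow> real"
      using u by (simp add: sum_divide_distrib)
    show ?thesis
      unfolding K H avg mean mean' by simp
  qed
  \<comment> \<open>Equality in either bound at a single interior point suffices, which serves both
    the pointwise and the global equivalences.\<close>
  have strict: "\<forall>i\<in>{1..n}. p i = 1 / n"
    if x: "0 < F x" "F x < 1" and eq: "mix_H M n X p x = F x \<or> F x = mix_K M n X p x" for x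
  proof -
    have S: "G x j < G x i" if "i \<in> {1..n}" "j \<in> {1..n}" "i < j" for i j
      unfolding G_def using assms(3) _ _ that
      by (rule order_cdf_strict_antimono) (simp_all add: F x)
    have S': "- G x (n - j + 1) < - G x (n - i + 1)"
      if "i \<in> {1..n}" "j \<in> {1..n}" "i < j" for i j
      using that by (auto intro!: S)
    from eq show ?thesis
    proof
      assume "mix_H M n X p x = F x"
      then have "(\<Sum>i=1..n. - G x (n - i + 1)) / n = (\<Sum>i=1..n. p i * - G x (n - i + 1))"
        unfolding mean' H by simp
      then show ?thesis
        using D_plus_1_weighted_sum_eq[of p n "\<lambda>i. - G x (n - i + 1)", OF p n G' S'] by blast
    next
      assume "F x = mix_K M n X p x"
      then have "(\<Sum>i=1..n. G x i) / n = (\<Sum>i=1..n. p i * G x i)"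
        unfolding mean K .
      then show ?thesis
        using D_plus_1_weighted_sum_eq[of p n "G x", OF p n G S] by blast
    qed
  qed
  show ?thesis
    using bounds uniform strict by blast
qed

end
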